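(* Let $H \in \mathbb{C}^{N\times N}$ be a complex matrix and let $S_h \in \mathbb{C}^{N\times N}$ be a family of invertible complex matrices depending smoothly on $h\in \mathbb{R}$ such that (i) the spectrum of $S_h$ satisfies $\sigma(S_h) =\overline{\mathrm{inv}(\sigma(S_h))}$; (ii) there exists $p\geq 1$ such that $S_h = e^{ihH} + \mathcal{O}(h^{p+1})$ as $h\to 0$; (iii) the eigenvalues of $H$ are real and simple. Then there exists a constant $C>0$ such that, provided that $|h|$ is small enough, for all $u\in \mathbb{C}^N$ and all eigenvalues $\omega \in \sigma(H)$, one has $$\sup_{n\geq 0} \, \Big||\Pi_\omega S_h^{n} u| - |\Pi_\omega u| \Big| \leq C |h|^p |u|.$$ Moreover, if $H$ is Hermitian, then (with such a constant $C$ and provided that $|h|$ is small enough) for all $u\in \mathbb{C}^N$, $$\sup_{n \in \mathbb{Z}} \, \big| \mathcal{M}(S_h^n u) - \mathcal{M}(u) \big|\leq C |h|^p |u|^2 \qquad \text{and} \qquad \sup_{n \in \mathbb{Z}} \, \big| \mathcal{H}(S_h^n u) - \mathcal{H}(u) \big| \leq C |h|^p |u|^2,$$ where $\mathcal{M}(u) = |u|^2$ and $\mathcal{H}(u) = \overline{u}^T H u$.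
   Context: $\sigma(A)$ denotes the set of eigenvalues of a matrix $A$; $\mathrm{inv}: z\mapsto z^{-1}$ is the inverse function; for a set $X\subset\mathbb{C}$ of nonzero numbers, $\mathrm{inv}(X)=\{z^{-1}: z\in X\}$ and $\overline{X}=\{\overline{z}: z\in X\}$. $\Pi_\omega$ denotes the spectral projector of $H$ onto $\mathrm{Ker}(H-\omega I_N)$ (i.e. the projection onto this eigenspace along the sum of the other eigenspaces of $H$). $|\cdot|$ on $\mathbb{C}^N$ is the Euclidean norm. The constant $C$ does not depend on $h$, $u$, $\omega$ or $n$. $N \ge 1$ and $p\ge 1$ are integers. *)

theory Defs
  imports
    "HOL-Analysis.Analysis"
    "HOL-Computational_Algebra.Polynomial"
    "HOL-Library.Landau_Symbols"
begin

text \<open>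
  Vectors are elements of \<^typ>\<open>complex ^ 'n\<close>, whose \<^const>\<open>norm\<close> is the Euclidean norm. Matrices are
  elements of \<^typ>\<open>complex ^ 'n ^ 'n\<close>, whose \<^const>\<open>norm\<close> is the Frobenius norm.
\<close>

subsection \<open>Eigenvalues\<close>

definition eigenspace :: "complex ^ 'n ^ 'n \<Rightarrow> complex \<Rightarrow> (complex ^ 'n) set" where
  "eigenspace A \<mu> = {v. A *v v = \<mu> *s v}"

definition spectrum :: "complex ^ 'n ^ 'n \<Rightarrow> complex set" where
  "spectrum A = {\<mu>. \<exists>v \<in> eigenspace A \<mu>. v \<noteq> 0}"

definition char_poly :: "complex ^ 'n ^ 'n \<Rightarrow> complex poly" where
  "char_poly A = det (mat [:0, 1:] - map_matrix (\<lambda>a. [:a:]) A)"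

text \<open>Simplicity refers to the algebraic multiplicity.\<close>

definition simple_eigenvalue :: "complex ^ 'n ^ 'n \<Rightarrow> complex \<Rightarrow> bool" where
  "simple_eigenvalue A \<mu> \<longleftrightarrow> \<mu> \<in> spectrum A \<and> order \<mu> (char_poly A) = 1"

text \<open>
  The component of \<open>u\<close> in the eigenspace of \<open>\<omega>\<close> along the sum of the other eigenspaces. It is
  specified only if \<open>u\<close> lies in the (always direct) sum of the eigenspaces of \<open>A\<close>; this holds for
  every \<open>u\<close> if \<open>A\<close> is diagonalizable, in particular if all eigenvalues of \<open>A\<close> are simple.
\<close>

definition spectral_projector :: "complex ^ 'n ^ 'n \<Rightarrow> complex \<Rightarrow> complex ^ 'n \<Rightarrow> complex ^ 'n" where
  "spectral_projector A \<omega> u =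
    (THE v. v \<in> eigenspace A \<omega> \<and>
            u - v \<in> vec.span (\<Union>\<mu> \<in> spectrum A - {\<omega>}. eigenspace A \<mu>))"

definition hermitian :: "complex ^ 'n ^ 'n \<Rightarrow> bool" where
  "hermitian A \<longleftrightarrow> transpose (map_matrix cnj A) = A"

subsection \<open>Powers and exponential\<close>

text \<open>
  The library's \<open>(^)\<close> and \<^const>\<open>exp\<close> are not usable for this purpose: the product on the type
  \<open>vec\<close> is the componentwise one.
\<close>

primrec mat_pow :: "complex ^ 'n ^ 'n \<Rightarrow> nat \<Rightarrow> complex ^ 'n ^ 'n" where
  "mat_pow A 0 = mat 1"
| "mat_pow A (Suc n) = A ** mat_pow A n"

definition mat_powi :: "complex ^ 'n ^ 'n \<Rightarrow> int \<Rightarrow> complex ^ 'n ^ 'n" where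
  "mat_powi A n = (if n \<ge> 0 then mat_pow A (nat n) else mat_pow (matrix_inv A) (nat (- n)))"

definition mat_exp :: "complex ^ 'n ^ 'n \<Rightarrow> complex ^ 'n ^ 'n" where
  "mat_exp A = (\<Sum>k. inverse (fact k) *\<^sub>R mat_pow A k)"

subsection \<open>Smoothness\<close>

text \<open>The function \<open>D k\<close> is the \<open>k\<close>-th derivative of \<open>f\<close>.\<close>

definition smooth :: "(real \<Rightarrow> 'a::real_normed_vector) \<Rightarrow> bool" where
  "smooth f \<longleftrightarrow>
    (\<exists>D :: nat \<Rightarrow> real \<Rightarrow> 'a. D 0 = f \<and>
      (\<forall>k t. (D k has_vector_derivative D (Suc k) t) (at t)))"

subsection \<open>Mass and energy\<close>

definition mass :: "complex ^ 'n \<Rightarrow> real" where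
  "mass u = (norm u)\<^sup>2"

text \<open>
  For a Hermitian matrix this complex number is real, so that its \<^const>\<open>norm\<close> is the usual
  absolute value.
\<close>

definition energy :: "complex ^ 'n ^ 'n \<Rightarrow> complex ^ 'n \<Rightarrow> complex" where
  "energy H u = (\<Sum>i\<in>UNIV. cnj (u $ i) * (H *v u) $ i)"

end

theory Submission
  imports Defs "HOL-Computational_Algebra.Fundamental_Theorem_Algebra"
begin

text \<open>
  The estimates hold for all times because \<open>S h\<close> turns out to be diagonalizable with eigenvalues on
  the unit circle, in an eigenbasis that is close to the one of \<open>H\<close>.

  In an eigenbasis of \<open>H\<close> (\<open>simple_eigenvalues_diagonalize\<close>) the matrix \<open>S h\<close> becomes
  \<open>diag_mat D + E\<close>, where \<open>D\<close> has the entries \<open>exp (\<i> * h * \<omega>)\<close> for the eigenvalues \<open>\<omega>\<close> of \<open>H\<close> and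
  \<open>norm E\<close> is of order \<open>p + 1\<close> in \<open>h\<close>. The entries of \<open>D\<close> have mutual distance at least a multiple
  of \<open>\<bar>h\<bar>\<close> (\<open>eventually_exp_gaps\<close>). Perturbing a diagonal matrix with gap \<open>\<delta>\<close> by \<open>E\<close> moves the
  eigenvalues by \<open>O(norm E)\<close> and the eigenvectors by \<open>O(norm E / \<delta>)\<close> (\<open>perturbed_eigenvector\<close>), which
  here is of order \<open>p\<close>. The eigenvectors are obtained from Brouwer's fixed point theorem.

  The spectrum of \<open>S h\<close> is invariant under reflection in the unit circle. Each of its eigenvalues is
  much closer to the circle than to the other eigenvalues, so its mirror image can only be itself:
  it has modulus 1 (\<open>reflection_symmetric_near_unit_circle\<close>). Powers of \<open>S h\<close> then only rotate the
  coordinates with respect to the eigenbasis of \<open>S h\<close>, and passing between the two eigenbases at the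
  initial and at the final time costs an error of order \<open>p\<close> that is independent of the number of
  steps (\<open>near_conservation\<close>).

  If \<open>H\<close> is Hermitian, its eigenspaces are orthogonal, and mass and energy are weighted sums of the
  squared norms of the spectral components (\<open>mass_energy_spectral\<close>), so that they inherit the
  estimate.
\<close>

section \<open>Similar matrices\<close>

lemma matrix_inv_left:
  fixes P :: "'a::field ^ 'n ^ 'n"
  assumes "invertible P"
  shows "matrix_inv P ** P = mat 1"
  using someI_ex[OF assms[unfolded invertible_def]] unfolding matrix_inv_def by blast

lemma matrix_inv_right:
  fixes P :: "'a::field ^ 'n ^ 'n"
  assumes "invertible P"
  shows "P ** matrix_inv P = mat 1"
  using someI_ex[OF assms[unfolded invertible_def]] unfolding matrix_inv_def by blast

lemma matrix_inv_unique:
  fixes P :: "'a::field ^ 'n ^ 'n"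
  assumes "P ** B = mat 1"
  shows "matrix_inv P = B"
proof -
  have "invertible P"
    using assms matrix_left_right_inverse unfolding invertible_def by blast
  then have "matrix_inv P ** (P ** B) = B"
    by (simp add: matrix_mul_assoc matrix_inv_left)
  then show ?thesis
    using assms by simp
qed

lemma invertible_if_kernel_trivial:
  fixes P :: "'a::field ^ 'n ^ 'n"
  assumes "\<And>x. P *v x = 0 \<Longrightarrow> x = 0"
  shows "invertible P"
  using assms invertible_left_inverse matrix_left_invertible_ker by blast

lemma matrix_inv_mult_vec:
  fixes P :: "'a::field ^ 'n ^ 'n"
  assumes "invertible P"
  shows "matrix_inv P *v (P *v x) = x" "P *v (matrix_inv P *v x) = x"
  using assms by (simp_all add: matrix_vector_mul_assoc matrix_inv_left matrix_inv_right)

text \<open>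
  A relation \<open>A ** P = P ** B\<close> with invertible \<open>P\<close> says that \<open>A\<close> and \<open>B\<close> are similar. Stated without
  an inverse it passes to powers by plain associativity, and for diagonal \<open>B\<close> it says that the
  columns of \<open>P\<close> are eigenvectors of \<open>A\<close>.
\<close>

lemma spectrum_intertwined:
  fixes A B P :: "complex ^ 'n ^ 'n"
  assumes P: "invertible P" and AB: "A ** P = P ** B"
  shows "spectrum A = spectrum B"
proof -
  have eigen: "P *v x \<in> eigenspace A \<mu> \<longleftrightarrow> x \<in> eigenspace B \<mu>" for \<mu> x
  proof -
    have "A *v (P *v x) = P *v (B *v x)"
      by (simp add: AB matrix_vector_mul_assoc)
    moreover have "\<mu> *s (P *v x) = P *v (\<mu> *s x)"
      by (simp add: vector_scalar_commute)
    ultimately show ?thesis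
      using inj_matrix_vector_mult[OF P] by (simp add: eigenspace_def inj_eq)
  qed
  have nonzero: "P *v x = 0 \<longleftrightarrow> x = 0" for x
    using matrix_inv_mult_vec(1)[OF P, of x] by auto
  have "(\<exists>v\<in>eigenspace A \<mu>. v \<noteq> 0) \<longleftrightarrow> (\<exists>x\<in>eigenspace B \<mu>. x \<noteq> 0)" for \<mu>
  proof
    assume "\<exists>v\<in>eigenspace A \<mu>. v \<noteq> 0"
    then obtain v where "v \<in> eigenspace A \<mu>" "v \<noteq> 0"
      by blast
    then show "\<exists>x\<in>eigenspace B \<mu>. x \<noteq> 0"
      using eigen[of "matrix_inv P *v v" \<mu>] nonzero[of "matrix_inv P *v v"]
      by (auto simp: matrix_inv_mult_vec[OF P])
  next
    assume "\<exists>x\<in>eigenspace B \<mu>. x \<noteq> 0"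
    then show "\<exists>v\<in>eigenspace A \<mu>. v \<noteq> 0"
      using eigen nonzero by blast
  qed
  then show ?thesis
    unfolding spectrum_def by simp
qed

lemma mat_pow_intertwined:
  assumes "A ** P = P ** B"
  shows "mat_pow A n ** P = P ** mat_pow B n"
proof (induction n)
  case (Suc n)
  have "mat_pow A (Suc n) ** P = A ** (P ** mat_pow B n)"
    using Suc by (simp flip: matrix_mul_assoc)
  also have "\<dots> = P ** mat_pow B (Suc n)"
    using assms by (simp add: matrix_mul_assoc)
  finally show ?case .
qed simp

lemma mat_powi_intertwined:
  fixes A B P :: "complex ^ 'n ^ 'n"
  assumes A: "invertible A" and B: "invertible B" and AB: "A ** P = P ** B"
  shows "mat_powi A n ** P = P ** mat_powi B n"
proof -
  have "matrix_inv A ** P = matrix_inv A ** (P ** B) ** matrix_inv B"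
    by (metis matrix_inv_right[OF B] matrix_mul_assoc matrix_mul_rid)
  also have "\<dots> = P ** matrix_inv B"
    by (metis matrix_inv_left[OF A] AB matrix_mul_assoc matrix_mul_lid)
  finally show ?thesis
    unfolding mat_powi_def using AB by (auto intro: mat_pow_intertwined)
qed

lemma mat_pow_mat_1 [simp]: "mat_pow (mat 1) n = mat 1"
  by (induction n) simp_all

lemma mat_powi_mat_1 [simp]: "mat_powi (mat 1) n = (mat 1 :: complex ^ 'n ^ 'n)"
  unfolding mat_powi_def using matrix_inv_unique[of "mat 1 :: complex ^ 'n ^ 'n" "mat 1"] by simp

section \<open>Diagonal matrices\<close>

definition diag_mat :: "complex ^ 'n \<Rightarrow> complex ^ 'n ^ 'n" where
  "diag_mat d = (\<chi> i j. if i = j then d $ i else 0)"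

lemma diag_mat_mult_vec [simp]: "diag_mat d *v x = d * x"
proof -
  have "(diag_mat d *v x) $ i = (\<Sum>j\<in>UNIV. if i = j then d $ i * x $ j else 0)" for i
    unfolding diag_mat_def matrix_vector_mult_def
    by (simp add: if_distrib[of "\<lambda>c. c * _"] cong: if_cong)
  then show ?thesis
    by (simp add: vec_eq_iff)
qed

lemma diag_mat_mult: "diag_mat d ** diag_mat e = diag_mat (d * e)"
  by (simp add: matrix_eq mult.assoc flip: matrix_vector_mul_assoc)

lemma diag_mat_1: "diag_mat 1 = mat 1"
  by (simp add: matrix_eq)

lemma spectrum_diag_mat:
  fixes d :: "complex ^ 'n"
  shows "spectrum (diag_mat d) = range (($) d)"
proof -
  have "\<exists>v::complex ^ 'n. d * v = \<mu> *s v \<and> v \<noteq> 0" if "\<mu> = d $ j" for \<mu> j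
    by (rule exI[of _ "axis j 1"]) (auto simp: that vec_eq_iff axis_def)
  moreover have "\<mu> \<in> range (($) d)" if eq: "d * v = \<mu> *s v" and nz: "v \<noteq> 0" for \<mu> and v :: "complex ^ 'n"
  proof -
    obtain j where "v $ j \<noteq> 0"
      using nz by (auto simp: vec_eq_iff)
    moreover have "d $ j * v $ j = \<mu> * v $ j"
      using eq by (metis vector_mult_component vector_smult_component)
    ultimately show ?thesis
      by auto
  qed
  ultimately show ?thesis
    unfolding spectrum_def eigenspace_def by auto
qed

lemma invertible_diag_mat:
  assumes "\<And>i. d $ i \<noteq> 0"
  shows "invertible (diag_mat d)"
  using assms by (intro invertible_if_kernel_trivial) (auto simp: vec_eq_iff)

lemma mat_pow_diag_mat: "mat_pow (diag_mat d) n = diag_mat (\<chi> i. d $ i ^ n)"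
proof (induction n)
  case 0
  show ?case
    by (simp add: matrix_eq vec_eq_iff)
next
  case (Suc n)
  have "d * (\<chi> i. d $ i ^ n) = (\<chi> i. d $ i ^ Suc n)"
    by (simp add: vec_eq_iff)
  with Suc show ?case
    by (simp add: diag_mat_mult)
qed

lemma mat_powi_diag_mat:
  assumes "\<And>i. d $ i \<noteq> 0"
  shows "mat_powi (diag_mat d) n = diag_mat (\<chi> i. d $ i powi n)"
proof -
  have "d * (\<chi> i. inverse (d $ i)) = 1"
    using assms by (simp add: vec_eq_iff)
  then have "matrix_inv (diag_mat d) = diag_mat (\<chi> i. inverse (d $ i))"
    by (intro matrix_inv_unique) (simp add: diag_mat_mult diag_mat_1)
  then show ?thesis
    by (simp add: mat_powi_def mat_pow_diag_mat power_int_def power_inverse)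
qed

lemma linear_diag_mat:
  fixes P :: "complex ^ 'n ^ 'm" and Q :: "complex ^ 'k ^ 'n"
  shows "linear (\<lambda>d. P ** diag_mat d ** Q)"
proof (rule linearI)
  have add: "diag_mat (c + d) = diag_mat c + diag_mat d"
    and scale: "diag_mat (a *\<^sub>R d) = a *\<^sub>R diag_mat d" for a c d
    by (simp_all add: diag_mat_def vec_eq_iff)
  show "P ** diag_mat (c + d) ** Q = P ** diag_mat c ** Q + P ** diag_mat d ** Q" for c d
    by (simp add: add matrix_add_ldistrib matrix_eq matrix_vector_mult_add_rdistrib
        matrix_vector_right_distrib flip: matrix_vector_mul_assoc)
  show "P ** diag_mat (a *\<^sub>R d) ** Q = a *\<^sub>R (P ** diag_mat d ** Q)" for a d
    by (simp add: scale matrix_scalar_ac scalar_matrix_assoc)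
qed

text \<open>
  The map that sends a vector \<open>d\<close> to the matrix with eigenvalues \<open>d\<close> in the basis \<open>P\<close> is linear, hence
  continuous, so that it carries the componentwise exponential series to the matrix series. In
  particular the series defining \<^const>\<open>mat_exp\<close> converges.
\<close>

lemma mat_exp_diagonalized:
  fixes A P :: "complex ^ 'n ^ 'n"
  assumes P: "invertible P" and AP: "A ** P = P ** diag_mat d"
  shows "mat_exp A = P ** diag_mat (\<chi> i. exp (d $ i)) ** matrix_inv P"
proof -
  let ?L = "\<lambda>d. P ** diag_mat d ** matrix_inv P"
  have "mat_pow A k = ?L (\<chi> i. d $ i ^ k)" for k
  proof -
    have "mat_pow A k = mat_pow A k ** P ** matrix_inv P"
      using P by (simp add: matrix_inv_right flip: matrix_mul_assoc)
    then show ?thesis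
      using mat_pow_intertwined[OF AP] by (simp add: mat_pow_diag_mat)
  qed
  moreover have "(\<lambda>k. inverse (fact k) *\<^sub>R (\<chi> i. d $ i ^ k)) sums (\<chi> i. exp (d $ i))"
    unfolding sums_def
  proof (rule vec_tendstoI)
    show "(\<lambda>n. (\<Sum>k<n. inverse (fact k) *\<^sub>R (\<chi> i. d $ i ^ k)) $ i) \<longlonglongrightarrow> (\<chi> i. exp (d $ i)) $ i" for i
      using exp_converges[of "d $ i"] by (simp add: sums_def)
  qed
  then have "(\<lambda>k. ?L (inverse (fact k) *\<^sub>R (\<chi> i. d $ i ^ k))) sums ?L (\<chi> i. exp (d $ i))"
    by (rule bounded_linear.sums[OF linear_conv_bounded_linear[THEN iffD1, OF linear_diag_mat]])
  ultimately have "(\<lambda>k. inverse (fact k) *\<^sub>R mat_pow A k) sums ?L (\<chi> i. exp (d $ i))"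
    by (simp add: linear_cmul[OF linear_diag_mat])
  then show ?thesis
    unfolding mat_exp_def by (rule sums_unique[symmetric])
qed

section \<open>Matrices with simple eigenvalues\<close>

lemma poly_char_poly: "poly (char_poly A) \<mu> = det (mat \<mu> - A)"
proof -
  have "poly (char_poly A) \<mu> = (\<Sum>\<pi> | \<pi> permutes UNIV. of_int (sign \<pi>) *
      (\<Prod>i\<in>UNIV. poly ((mat [:0, 1:] - map_matrix (\<lambda>a. [:a:]) A) $ i $ \<pi> i) \<mu>))"
    unfolding char_poly_def det_def by (simp add: poly_sum poly_prod poly_mult)
  also have "\<dots> = det (mat \<mu> - A)"
    unfolding det_def by (intro sum.cong refl arg_cong2[where f = "(*)"] prod.cong) (auto simp: mat_def)
  finally show ?thesis .
qed

lemma poly_char_poly_eq_0_iff: "poly (char_poly A) \<mu> = 0 \<longleftrightarrow> \<mu> \<in> spectrum A"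
proof -
  have "mat \<mu> *v v = \<mu> *s v" for v :: "complex ^ 'a"
    by (simp add: vec_eq_iff matrix_vector_mult_def mat_def if_distrib[of "\<lambda>c. c * _"] cong: if_cong)
  then have "(mat \<mu> - A) *v v = 0 \<longleftrightarrow> v \<in> eigenspace A \<mu>" for v
    by (auto simp: eigenspace_def matrix_vector_mult_diff_rdistrib)
  moreover have "det (mat \<mu> - A) \<noteq> 0 \<longleftrightarrow> (\<forall>v. (mat \<mu> - A) *v v = 0 \<longrightarrow> v = 0)"
    using invertible_det_nz[of "mat \<mu> - A"] invertible_left_inverse[of "mat \<mu> - A"]
      matrix_left_invertible_ker[of "mat \<mu> - A"] by metis
  ultimately show ?thesis
    unfolding poly_char_poly spectrum_def by auto
qed

text \<open>
  In the Leibniz expansion only the identity permutation picks up the indeterminate in every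
  factor; every other permutation contributes a term of smaller degree.
\<close>

lemma degree_char_poly: "degree (char_poly (A :: complex ^ 'n ^ 'n)) = CARD('n)"
proof -
  define M where "M = mat [:0, 1:] - map_matrix (\<lambda>a. [:a:]) A"
  have entry: "M $ i $ j = (if i = j then [:- A $ i $ j, 1:] else [:- A $ i $ j:])" for i j
    by (auto simp: M_def mat_def)
  define t where "t \<pi> = of_int (sign \<pi>) * (\<Prod>i\<in>UNIV. M $ i $ \<pi> i)" for \<pi>
  have id: "degree (t id) = CARD('n)"
    by (simp add: t_def entry degree_prod_eq_sum_degree)
  have other: "degree (t \<pi>) < CARD('n)" if nid: "\<pi> \<noteq> id" for \<pi> :: "'n \<Rightarrow> 'n"
  proof -
    obtain i where i: "i \<noteq> \<pi> i"
      using nid by (metis eq_id_iff)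
    have "degree (of_int (sign \<pi>) :: complex poly) = 0"
      by simp
    then have "degree (t \<pi>) \<le> degree (\<Prod>i\<in>UNIV. M $ i $ \<pi> i)"
      using degree_mult_le[of "of_int (sign \<pi>)" "\<Prod>i\<in>UNIV. M $ i $ \<pi> i"] by (simp add: t_def)
    also have "\<dots> \<le> (\<Sum>i\<in>UNIV. degree (M $ i $ \<pi> i))"
      by (intro degree_prod_sum_le[unfolded o_def]) simp
    also have "\<dots> < (\<Sum>i\<in>(UNIV :: 'n set). 1)"
      using i by (intro sum_strict_mono_ex1) (auto simp: entry)
    finally show ?thesis
      by simp
  qed
  have "char_poly A = t id + (\<Sum>\<pi> | \<pi> permutes UNIV \<and> \<pi> \<noteq> id. t \<pi>)"
  proof -
    have "char_poly A = (\<Sum>\<pi> | \<pi> permutes UNIV. t \<pi>)"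
      by (simp add: char_poly_def det_def t_def M_def)
    also have "\<dots> = t id + sum t ({\<pi>. \<pi> permutes UNIV} - {id})"
      by (intro sum.remove) (auto simp: permutes_id)
    finally show ?thesis
      by (simp add: set_diff_eq)
  qed
  moreover have "degree (\<Sum>\<pi> | \<pi> permutes (UNIV :: 'n set) \<and> \<pi> \<noteq> id. t \<pi>) < CARD('n)"
  proof -
    have "degree (\<Sum>\<pi> | \<pi> permutes (UNIV :: 'n set) \<and> \<pi> \<noteq> id. t \<pi>) \<le> CARD('n) - 1"
      by (intro degree_sum_le) (auto dest!: other)
    then show ?thesis
      by (metis (no_types) diff_less le_less_trans less_one zero_less_card_finite)
  qed
  ultimately show ?thesis
    using id by (simp add: degree_add_eq_left)
qed

text \<open>
  By the fundamental theorem of algebra the multiplicities of the roots add up to the degree, and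
  here each of them is 1.
\<close>

lemma card_spectrum_simple:
  fixes A :: "complex ^ 'n ^ 'n"
  assumes "\<And>\<omega>. \<omega> \<in> spectrum A \<Longrightarrow> simple_eigenvalue A \<omega>"
  shows "card (spectrum A) = CARD('n)"
proof -
  let ?p = "char_poly A"
  have p: "?p \<noteq> 0"
    using degree_char_poly[of A] by auto
  have spec: "spectrum A = {z. poly ?p z = 0}"
    by (simp add: poly_char_poly_eq_0_iff)
  have "CARD('n) = size (proots ?p)"
    by (simp add: size_proots_complex degree_char_poly)
  also have "\<dots> = (\<Sum>z | poly ?p z = 0. order z ?p)"
    using p by (simp add: size_multiset_overloaded_eq)
  also have "\<dots> = card (spectrum A)"
    unfolding spec[symmetric] using assms by (simp add: simple_eigenvalue_def)
  finally show ?thesis ..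
qed

text \<open>
  Applying \<open>A - \<omega> a\<close> to a vanishing combination of eigenvectors removes the term with index
  \<open>a\<close> and multiplies the others by nonzero numbers.
\<close>

lemma eigenvectors_independent:
  assumes "finite I" "inj_on \<omega> I"
    and "\<And>i. i \<in> I \<Longrightarrow> A *v v i = \<omega> i *s v i" "\<And>i. i \<in> I \<Longrightarrow> v i \<noteq> 0"
    and "(\<Sum>i\<in>I. x i *s v i) = 0" "i \<in> I"
  shows "x i = (0 :: complex)"
  using assms
proof (induction I arbitrary: x i rule: finite_induct)
  case (insert a I)
  have lin: "A *v (\<Sum>i\<in>insert a I. x i *s v i) = (\<Sum>i\<in>insert a I. (x i * \<omega> i) *s v i)"
    using insert.prems(2) by (simp add: vec.linear_sum[OF matrix_vector_mul_linear_gen]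
        vector_scalar_commute vector_smult_assoc del: sum.insert)
  have "(\<Sum>i\<in>insert a I. (x i * (\<omega> i - \<omega> a)) *s v i) = 0"
  proof -
    have "(\<Sum>i\<in>insert a I. (x i * (\<omega> i - \<omega> a)) *s v i) =
        (\<Sum>i\<in>insert a I. (x i * \<omega> i) *s v i) - \<omega> a *s (\<Sum>i\<in>insert a I. x i *s v i)"
      by (simp only: vec.scale_sum_right sum_subtractf[symmetric] vector_smult_assoc
          vector_sub_rdistrib right_diff_distrib mult.commute)
    then show ?thesis
      using lin insert.prems(4) by simp
  qed
  then have "(\<Sum>i\<in>I. (x i * (\<omega> i - \<omega> a)) *s v i) = 0"
    using insert.hyps by simp
  then have "x i * (\<omega> i - \<omega> a) = 0" if "i \<in> I" for i
    using insert.IH[of "\<lambda>i. x i * (\<omega> i - \<omega> a)" i] insert.prems that by auto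
  then have x0: "x i = 0" if "i \<in> I" for i
    using insert.prems(1) insert.hyps that by (metis eq_iff_diff_eq_0 inj_on_contraD insertCI mult_eq_0_iff)
  then have "x a *s v a = 0"
    using insert.prems(4) insert.hyps by simp
  then have "x a = 0"
    using insert.prems(3) by simp
  then show ?case
    using x0 insert.prems(5) by auto
qed simp

lemma simple_eigenvalues_diagonalize:
  fixes A :: "complex ^ 'n ^ 'n"
  assumes "\<And>\<omega>. \<omega> \<in> spectrum A \<Longrightarrow> simple_eigenvalue A \<omega>"
  obtains P :: "complex ^ 'n ^ 'n" and d where "invertible P" "A ** P = P ** diag_mat d" "inj (($) d)"
proof -
  have "finite (spectrum A)"
    using card_spectrum_simple[OF assms] by (metis card.infinite zero_less_card_finite less_irrefl)
  then obtain \<omega> where \<omega>: "bij_betw \<omega> (UNIV :: 'n set) (spectrum A)"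
    using card_spectrum_simple[OF assms] by (metis finite_same_card_bij finite)
  have "\<exists>v. A *v v = \<omega> i *s v \<and> v \<noteq> 0" for i
    using bij_betwE[OF \<omega>] by (auto simp: spectrum_def eigenspace_def)
  then obtain v where v: "A *v v i = \<omega> i *s v i" "v i \<noteq> 0" for i
    by metis
  define P where "P = (\<chi> i j. v j $ i)"
  have Px: "P *v x = (\<Sum>j\<in>UNIV. x $ j *s v j)" for x
    by (simp add: P_def matrix_vector_mult_def vec_eq_iff mult.commute)
  have inj: "inj \<omega>"
    using \<omega> by (simp add: bij_betw_def)
  have "x $ j = 0" if "P *v x = 0" for x j
    by (rule eigenvectors_independent[OF finite inj]) (use v that in \<open>auto simp: Px\<close>)
  then have "x = 0" if "P *v x = 0" for x
    using that by (simp add: vec_eq_iff)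
  then have "invertible P"
    by (rule invertible_if_kernel_trivial)
  moreover have "A ** P = P ** diag_mat (vec_lambda \<omega>)"
  proof -
    have "A *v (P *v x) = P *v (vec_lambda \<omega> * x)" for x
      unfolding Px by (simp add: vec.linear_sum[OF matrix_vector_mul_linear_gen]
          vector_scalar_commute vector_smult_assoc v mult.commute)
    then show ?thesis
      by (simp add: matrix_eq flip: matrix_vector_mul_assoc)
  qed
  moreover have "inj (($) (vec_lambda \<omega>))"
    using inj by (simp add: inj_def)
  ultimately show thesis
    by (rule that)
qed

lemma matrix_vector_mult_axis:
  fixes A :: "complex ^ 'n ^ 'm"
  shows "A *v axis k 1 = column k A"
  by (simp add: vec_eq_iff matrix_vector_mult_def column_def axis_def
      if_distrib[of "\<lambda>c. _ * c"] cong: if_cong)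

text \<open>
  In the coordinates given by an eigenbasis, the eigenspace of \<open>d $ j\<close> consists of the vectors whose
  coordinates other than the \<open>j\<close>-th vanish, since the entries of \<open>d\<close> are distinct. The other
  eigenspaces lie in the hyperplane where the \<open>j\<close>-th coordinate vanishes. This gives uniqueness
  in the definition of the projector; existence is the expansion of \<open>u\<close> in the eigenbasis.
\<close>

lemma spectral_projector_diagonalized:
  fixes A P :: "complex ^ 'n ^ 'n"
  assumes P: "invertible P" and AP: "A ** P = P ** diag_mat d" and d: "inj (($) d)"
  shows "spectral_projector A (d $ j) u = (matrix_inv P *v u) $ j *s column j P"
proof -
  let ?c = "\<lambda>v. matrix_inv P *v v"
  let ?U = "\<Union>\<mu>\<in>spectrum A - {d $ j}. eigenspace A \<mu>"
  let ?v = "?c u $ j *s column j P"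
  have spec: "spectrum A = range (($) d)"
    using spectrum_intertwined[OF P AP] by (simp add: spectrum_diag_mat)
  \<comment> \<open>An eigenvector can have nonzero coordinates only at indices that carry its eigenvalue.\<close>
  have eigen: "v \<in> eigenspace A \<mu> \<longleftrightarrow> (\<forall>k. ?c v $ k = 0 \<or> d $ k = \<mu>)" for v \<mu>
  proof -
    have "A *v v = P *v (d * ?c v)"
      by (metis AP P diag_mat_mult_vec matrix_inv_mult_vec(2) matrix_vector_mul_assoc)
    moreover have "\<mu> *s v = P *v (\<mu> *s ?c v)"
      using P by (simp add: matrix_inv_mult_vec flip: vector_scalar_commute)
    ultimately have "v \<in> eigenspace A \<mu> \<longleftrightarrow> d * ?c v = \<mu> *s ?c v"
      using inj_matrix_vector_mult[OF P] by (simp add: eigenspace_def inj_eq)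
    then show ?thesis
      by (auto simp: vec_eq_iff)
  qed
  have c_column: "?c (column k P) = axis k 1" for k
    using matrix_inv_mult_vec(1)[OF P, of "axis k 1"] by (simp add: matrix_vector_mult_axis)
  have c_scale: "?c (a *s v) = a *s ?c v" for a v
    by (simp add: vector_scalar_commute)
  have span: "?c v $ j = 0" if "v \<in> vec.span ?U" for v
    using that
  proof (induction rule: vec.span_induct_alt)
    case (step a x y)
    then have "?c x $ j = 0"
      by (auto simp: eigen)
    with step show ?case
      by (simp add: matrix_vector_right_distrib c_scale)
  qed simp
  show ?thesis
    unfolding spectral_projector_def
  proof (rule the_equality, intro conjI)
    show "?v \<in> eigenspace A (d $ j)"
      by (auto simp: eigen c_scale c_column axis_def)
    have "column k P \<in> ?U" if "k \<noteq> j" for k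
      using that d by (auto simp: spec eigen c_column axis_def inj_eq intro!: bexI[of _ "d $ k"])
    then have "(\<Sum>k\<in>UNIV - {j}. ?c u $ k *s column k P) \<in> vec.span ?U"
      by (intro vec.span_sum vec.span_scale vec.span_base) auto
    moreover have "u = (\<Sum>k\<in>UNIV. ?c u $ k *s column k P)"
      by (metis P matrix_inv_mult_vec(2) matrix_mult_sum)
    then have "u = ?v + (\<Sum>k\<in>UNIV - {j}. ?c u $ k *s column k P)"
      by (metis (no_types, lifting) UNIV_I finite sum.remove)
    ultimately show "u - ?v \<in> vec.span ?U"
      by (metis (no_types, lifting) add_diff_cancel_left')
  next
    fix v
    assume v: "v \<in> eigenspace A (d $ j) \<and> u - v \<in> vec.span ?U"
    have "?c v $ j = ?c u $ j"
      using v span[of "u - v"] by (simp add: matrix_vector_mult_diff_distrib)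
    moreover have "?c v $ k = 0" if "k \<noteq> j" for k
      using v that d by (auto simp: eigen inj_eq)
    ultimately have "?c v = ?c u $ j *s axis j 1"
      by (auto simp: vec_eq_iff axis_def)
    then have "P *v ?c v = ?c u $ j *s (P *v axis j 1)"
      by (simp add: vector_scalar_commute)
    then show "v = ?v"
      using P by (simp add: matrix_inv_mult_vec matrix_vector_mult_axis)
  qed
qed

section \<open>Perturbation of diagonal matrices\<close>

lemma norm_vector_scalar_mult:
  fixes x :: "complex ^ 'n"
  shows "norm (c *s x) = norm c * norm x"
  by (simp add: norm_vec_def norm_mult L2_set_right_distrib)

lemma norm_vec_le_sum:
  fixes x :: "'a::real_normed_vector ^ 'n"
  shows "norm x \<le> (\<Sum>i\<in>UNIV. norm (x $ i))"
  unfolding norm_vec_def by (rule L2_set_le_sum) simp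

lemma norm_matrix_vector_mult_le:
  fixes A :: "complex ^ 'n ^ 'm"
  shows "norm (A *v x) \<le> norm A * norm x"
proof -
  have "norm ((A *v x) $ i) \<le> norm (A $ i) * norm x" for i
  proof -
    have "norm ((A *v x) $ i) \<le> (\<Sum>j\<in>UNIV. \<bar>norm (A $ i $ j)\<bar> * \<bar>norm (x $ j)\<bar>)"
      unfolding matrix_vector_mult_def by (simp add: sum_norm_le norm_mult)
    also have "\<dots> \<le> norm (A $ i) * norm x"
      unfolding norm_vec_def by (rule L2_set_mult_ineq)
    finally show ?thesis .
  qed
  then have "norm (A *v x) \<le> L2_set (\<lambda>i. norm (A $ i) * norm x) UNIV"
    unfolding norm_vec_def[of "A *v x"] by (intro L2_set_mono) auto
  also have "\<dots> = norm A * norm x"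
    by (simp add: norm_vec_def[of A] L2_set_left_distrib)
  finally show ?thesis .
qed

text \<open>
  Normalise the sought eigenvector to have \<open>j\<close>-th coordinate 1, say \<open>v = e + w\<close> with \<open>e\<close> the
  \<open>j\<close>-th unit vector. Row \<open>j\<close> of the eigenvalue equation then dictates the eigenvalue
  \<open>d $ j + (E *v v) $ j\<close>, and the other rows say
  \<open>(d $ k - d $ j) * w $ k = (E *v v) $ j * w $ k - (E *v v) $ k\<close>. Dividing by the gap turns
  this into a fixed point equation for a continuous self-map of a small ball, to which Brouwer's
  theorem applies.
\<close>

lemma perturbed_eigenvector:
  fixes d :: "complex ^ 'n" and E :: "complex ^ 'n ^ 'n" and r :: real
  assumes gap: "\<And>k. k \<noteq> j \<Longrightarrow> \<delta> \<le> norm (d $ k - d $ j)" and "\<delta> > 0"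
    and r: "r = 4 * real CARD('n) * norm E / \<delta>" "r \<le> 1"
  obtains w where "norm w \<le> r"
    and "(diag_mat d + E) *v (axis j 1 + w) = (d $ j + (E *v (axis j 1 + w)) $ j) *s (axis j 1 + w)"
proof -
  define v where "v w = axis j 1 + w" for w :: "complex ^ 'n"
  define T where "T w = (\<chi> k. if k = j then 0
      else ((E *v v w) $ j * w $ k - (E *v v w) $ k) / (d $ k - d $ j))" for w
  have v: "norm (v w) \<le> 2" if "norm w \<le> r" for w
    using norm_triangle_ineq[of "axis j 1" w] that r(2) by (simp add: v_def)
  have T: "norm (T w) \<le> r" if w: "norm w \<le> r" for w
  proof -
    have Ev: "norm ((E *v v w) $ k) \<le> 2 * norm E" for k
    proof -
      have "norm ((E *v v w) $ k) \<le> norm E * norm (v w)"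
        using Finite_Cartesian_Product.norm_nth_le norm_matrix_vector_mult_le by (rule order_trans)
      also have "\<dots> \<le> norm E * 2"
        using v[OF w] by (intro mult_left_mono) auto
      finally show ?thesis
        by simp
    qed
    have "norm (T w $ k) \<le> 4 * norm E / \<delta>" for k
    proof (cases "k = j")
      case False
      have wk: "norm (w $ k) \<le> 1"
        using Finite_Cartesian_Product.norm_nth_le[of w k] w r(2) by linarith
      have "norm ((E *v v w) $ j * w $ k) \<le> 2 * norm E * 1"
        unfolding norm_mult using Ev wk by (intro mult_mono) auto
      then have "norm ((E *v v w) $ j * w $ k - (E *v v w) $ k) \<le> 4 * norm E"
        using norm_triangle_ineq4[of "(E *v v w) $ j * w $ k" "(E *v v w) $ k"] Ev[of k] by simp
      then show ?thesis
        using False gap[OF False] \<open>\<delta> > 0\<close> by (simp add: T_def norm_divide frac_le)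
    qed (use \<open>\<delta> > 0\<close> in \<open>simp add: T_def\<close>)
    then have "norm (T w) \<le> (\<Sum>k\<in>(UNIV :: 'n set). 4 * norm E / \<delta>)"
      by (intro order_trans[OF norm_vec_le_sum] sum_mono) auto
    then show ?thesis
      by (simp add: r(1) mult.commute mult.left_commute)
  qed
  have "continuous_on (cball 0 r) T"
  proof -
    have Ev: "continuous_on (cball 0 r) (\<lambda>w. (E *v v w) $ k)" for k
      unfolding v_def matrix_vector_mult_def vec_lambda_beta by (intro continuous_intros)
    have "continuous_on (cball 0 r) (\<lambda>w. T w $ k)" for k
    proof (cases "k = j")
      case False
      then have "d $ k - d $ j \<noteq> 0"
        using gap[of k] \<open>\<delta> > 0\<close> by auto
      with False show ?thesis
        unfolding T_def by (auto intro!: continuous_intros Ev)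
    qed (simp add: T_def)
    then show ?thesis
      using continuous_on_vec_lambda[of "cball 0 r" "\<lambda>k w. T w $ k"] by simp
  qed
  moreover have "T \<in> cball 0 r \<rightarrow> cball 0 r"
    using T by auto
  moreover have "cball (0 :: complex ^ 'n) r \<noteq> {}"
    using r(1) \<open>\<delta> > 0\<close> by (simp add: not_less)
  ultimately obtain w where w: "norm w \<le> r" "T w = w"
    using brouwer[of "cball 0 r" T] by auto
  have Tw: "w $ k = T w $ k" for k
    using w(2) by simp
  have wj: "w $ j = 0"
    unfolding Tw[of j] by (simp add: T_def)
  have "d $ k * v w $ k + (E *v v w) $ k = (d $ j + (E *v v w) $ j) * v w $ k" for k
  proof (cases "k = j")
    case True
    then show ?thesis
      using wj by (simp add: v_def axis_def)
  next
    case False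
    then have "d $ k - d $ j \<noteq> 0"
      using gap[of k] \<open>\<delta> > 0\<close> by auto
    moreover have "w $ k = ((E *v v w) $ j * w $ k - (E *v v w) $ k) / (d $ k - d $ j)"
      by (subst Tw) (simp add: T_def False)
    ultimately have "w $ k * (d $ k - d $ j) = (E *v v w) $ j * w $ k - (E *v v w) $ k"
      by (simp add: nonzero_eq_divide_eq)
    moreover have "v w $ k = w $ k"
      using False by (simp add: v_def axis_def)
    ultimately show ?thesis
      by (simp add: algebra_simps)
  qed
  then have "(diag_mat d + E) *v v w = (d $ j + (E *v v w) $ j) *s v w"
    by (simp add: vec_eq_iff matrix_vector_mult_add_rdistrib distrib_right)
  then show thesis
    using w(1) that unfolding v_def by blast
qed

text \<open>
  The normalised eigenvectors for the different \<open>j\<close>, taken as columns, form a matrix \<open>mat 1 + W\<close> with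
  small \<open>W\<close>.
\<close>

lemma perturbed_diagonalization:
  fixes d :: "complex ^ 'n" and E :: "complex ^ 'n ^ 'n" and r :: real
  assumes gap: "\<And>j k. k \<noteq> j \<Longrightarrow> \<delta> \<le> norm (d $ k - d $ j)" and "\<delta> > 0"
    and r: "r = 4 * real CARD('n) * norm E / \<delta>" "r \<le> 1"
  obtains W \<mu> where "(diag_mat d + E) ** (mat 1 + W) = (mat 1 + W) ** diag_mat \<mu>"
    and "\<And>j. norm (\<mu> $ j - d $ j) \<le> 2 * norm E"
    and "\<And>x. norm (W *v x) \<le> CARD('n) * r * norm x"
proof -
  have "\<exists>w. norm w \<le> r \<and>
      (diag_mat d + E) *v (axis j 1 + w) = (d $ j + (E *v (axis j 1 + w)) $ j) *s (axis j 1 + w)" for j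
    using perturbed_eigenvector[OF gap \<open>\<delta> > 0\<close> r] by metis
  then obtain w where w: "norm (w j) \<le> r"
    "(diag_mat d + E) *v (axis j 1 + w j) = (d $ j + (E *v (axis j 1 + w j)) $ j) *s (axis j 1 + w j)" for j
    by metis
  define W where "W = (\<chi> i j. w j $ i)"
  define \<mu> where "\<mu> = (\<chi> j. d $ j + (E *v (axis j 1 + w j)) $ j)"
  have W: "W *v x = (\<Sum>j\<in>UNIV. x $ j *s w j)" for x
    by (simp add: W_def matrix_vector_mult_def vec_eq_iff mult.commute)
  have W1: "(mat 1 + W) *v x = (\<Sum>j\<in>UNIV. x $ j *s (axis j 1 + w j))" for x
    by (simp add: matrix_vector_mult_add_rdistrib W vector_add_ldistrib sum.distrib basis_expansion)
  have "(diag_mat d + E) *v ((mat 1 + W) *v x) = (mat 1 + W) *v (\<mu> * x)" for x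
  proof -
    have "(diag_mat d + E) *v ((mat 1 + W) *v x) =
        (\<Sum>j\<in>UNIV. x $ j *s ((diag_mat d + E) *v (axis j 1 + w j)))"
      unfolding W1 by (simp only: vec.linear_sum[OF matrix_vector_mul_linear_gen] vector_scalar_commute)
    also have "\<dots> = (mat 1 + W) *v (\<mu> * x)"
      unfolding W1 w(2)
      by (simp only: \<mu>_def vector_smult_assoc vec_lambda_beta vector_mult_component mult.commute)
    finally show ?thesis .
  qed
  then have "(diag_mat d + E) ** (mat 1 + W) = (mat 1 + W) ** diag_mat \<mu>"
    by (simp add: matrix_eq flip: matrix_vector_mul_assoc)
  moreover have "norm (\<mu> $ j - d $ j) \<le> 2 * norm E" for j
  proof -
    have "norm (\<mu> $ j - d $ j) \<le> norm (E *v (axis j 1 + w j))"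
      by (simp add: \<mu>_def Finite_Cartesian_Product.norm_nth_le)
    also have "\<dots> \<le> norm E * norm (axis j 1 + w j)"
      by (rule norm_matrix_vector_mult_le)
    also have "norm (axis j 1 + w j) \<le> 2"
      using norm_triangle_ineq[of "axis j 1" "w j"] w(1)[of j] r(2) by simp
    finally show ?thesis
      by (simp add: mult_left_mono)
  qed
  moreover have "norm (W *v x) \<le> CARD('n) * r * norm x" for x
  proof -
    have "norm (W *v x) \<le> (\<Sum>j\<in>UNIV. norm (x $ j *s w j))"
      unfolding W by (rule norm_sum)
    also have "\<dots> \<le> (\<Sum>j\<in>(UNIV :: 'n set). norm x * r)"
      unfolding norm_vector_scalar_mult using w(1) by (intro sum_mono mult_mono) (auto simp: Finite_Cartesian_Product.norm_nth_le)
    finally show ?thesis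
      by (simp add: mult.commute mult.left_commute)
  qed
  ultimately show thesis
    by (rule that)
qed

lemma near_identity:
  fixes W :: "complex ^ 'n ^ 'n"
  assumes W: "\<And>x. norm (W *v x) \<le> \<rho> * norm x" and "\<rho> \<le> 1 / 2"
  shows "norm x \<le> 2 * norm ((mat 1 + W) *v x)" and "invertible (mat 1 + W)"
proof -
  show bound: "norm x \<le> 2 * norm ((mat 1 + W) *v x)" for x
  proof -
    have "norm x \<le> norm ((mat 1 + W) *v x) + norm (W *v x)"
      using norm_triangle_ineq4[of "(mat 1 + W) *v x" "W *v x"]
      by (simp add: matrix_vector_mult_add_rdistrib)
    moreover have "norm (W *v x) \<le> 1 / 2 * norm x"
      using W[of x] \<open>\<rho> \<le> 1 / 2\<close> by (meson mult_right_mono norm_ge_zero order_trans)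
    ultimately show ?thesis
      by simp
  qed
  show "invertible (mat 1 + W)"
  proof (rule invertible_if_kernel_trivial)
    show "x = 0" if "(mat 1 + W) *v x = 0" for x
      using bound[of x] that by simp
  qed
qed

text \<open>
  Reflection in the unit circle maps \<open>\<mu> $ j\<close> to some eigenvalue \<open>\<mu> $ k\<close>. Since \<open>d $ j\<close> is fixed
  by the reflection, the image is still close to \<open>d $ j\<close>, closer than any other eigenvalue can be;
  so \<open>\<mu> $ j\<close> is its own reflection.
\<close>

lemma reflection_symmetric_near_unit_circle:
  fixes d \<mu> :: "complex ^ 'n"
  assumes d: "\<And>j. norm (d $ j) = 1" and gap: "\<And>j k. k \<noteq> j \<Longrightarrow> \<delta> \<le> norm (d $ k - d $ j)"
    and close: "\<And>j. norm (\<mu> $ j - d $ j) \<le> \<epsilon>" and \<epsilon>: "\<epsilon> \<le> 1 / 2" "3 * \<epsilon> < \<delta>"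
    and symmetric: "cnj ` inverse ` range (($) \<mu>) \<subseteq> range (($) \<mu>)"
  shows "norm (\<mu> $ j) = 1"
proof -
  have "cnj (inverse (\<mu> $ j)) \<in> cnj ` inverse ` range (($) \<mu>)"
    by blast
  then obtain k where k: "\<mu> $ k = cnj (inverse (\<mu> $ j))"
    using symmetric by (metis (no_types, lifting) rangeE subsetD)
  have half: "1 / 2 \<le> norm (\<mu> $ j)"
    using norm_triangle_ineq2[of "d $ j" "d $ j - \<mu> $ j"] close[of j] \<epsilon>(1) d[of j]
    by (simp add: norm_minus_commute)
  then have nz: "\<mu> $ j \<noteq> 0"
    by auto
  have "k = j"
  proof (rule ccontr)
    assume "k \<noteq> j"
    have "\<mu> $ k - d $ j = (cnj (d $ j) - cnj (\<mu> $ j)) * d $ j / cnj (\<mu> $ j)"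
      using nz d[of j] complex_norm_square[of "d $ j"] by (simp add: k field_simps)
    then have "norm (\<mu> $ k - d $ j) = norm (cnj (d $ j - \<mu> $ j)) / norm (\<mu> $ j)"
      using d[of j] by (simp add: norm_mult norm_divide)
    also have "\<dots> \<le> \<epsilon> / (1 / 2)"
      unfolding complex_mod_cnj using close[of j] half norm_ge_zero[of "\<mu> $ j - d $ j"]
      by (intro frac_le) (auto simp: norm_minus_commute simp del: norm_ge_zero)
    finally have "norm (d $ k - d $ j) \<le> 3 * \<epsilon>"
      using norm_triangle_ineq[of "d $ k - \<mu> $ k" "\<mu> $ k - d $ j"] close[of k]
      by (simp add: norm_minus_commute)
    then show False
      using gap[OF \<open>k \<noteq> j\<close>] \<epsilon>(2) by simp
  qed
  then have "\<mu> $ j * cnj (\<mu> $ j) = 1"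
    using k nz by (simp add: field_simps)
  then have "(norm (\<mu> $ j))\<^sup>2 = 1"
    by (metis complex_norm_square of_real_eq_1_iff)
  then show ?thesis
    using norm_ge_zero[of "\<mu> $ j"] by (simp add: power2_eq_1_iff)
qed

text \<open>
  Expand \<open>y = (mat 1 + W) *v x\<close> in the eigenbasis of the perturbed matrix. An integer power multiplies
  the entries of \<open>x\<close> by complex numbers of modulus 1, which leaves their absolute values unchanged
  for all times. The coordinates of \<open>y\<close> and of its image differ from those of \<open>x\<close> and of its image by a
  term of the size of \<open>W\<close>, once at the beginning and once at the end, and this error does not
  accumulate with \<open>n\<close>.
\<close>

lemma near_conservation:
  fixes d :: "complex ^ 'n" and E :: "complex ^ 'n ^ 'n"
  assumes d: "\<And>j. norm (d $ j) = 1" and gap: "\<And>j k. k \<noteq> j \<Longrightarrow> \<delta> \<le> norm (d $ k - d $ j)"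
    and "\<delta> > 0" and small: "norm E \<le> 1 / 4" "8 * (CARD('n))\<^sup>2 * norm E \<le> \<delta>"
    and symmetric: "cnj ` inverse ` spectrum (diag_mat d + E) \<subseteq> spectrum (diag_mat d + E)"
  shows "\<bar>norm ((mat_powi (diag_mat d + E) n *v y) $ j) - norm (y $ j)\<bar>
    \<le> 16 * (CARD('n))\<^sup>2 * norm E / \<delta> * norm y"
proof -
  let ?A = "diag_mat d + E"
  let ?N = "real CARD('n)"
  define r where "r = 4 * ?N * norm E / \<delta>"
  define \<rho> where "\<rho> = ?N * r"
  have N: "1 \<le> ?N"
    by (simp add: Suc_le_eq)
  have "r \<ge> 0"
    using \<open>\<delta> > 0\<close> by (simp add: r_def)
  \<comment> \<open>Here \<open>r\<close> bounds the columns of \<open>W\<close> and \<open>\<rho>\<close> bounds \<open>W\<close> as an operator. The second smallness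
      hypothesis is exactly \<open>\<rho> \<le> 1 / 2\<close>.\<close>
  have "\<rho> \<le> 1 / 2"
    using small(2) \<open>\<delta> > 0\<close> by (simp add: \<rho>_def r_def field_simps power2_eq_square)
  moreover have "r \<le> \<rho>"
    using N \<open>r \<ge> 0\<close> by (simp add: \<rho>_def mult_le_cancel_right1)
  ultimately have "r \<le> 1"
    by simp
  then obtain W \<mu> where AV: "?A ** (mat 1 + W) = (mat 1 + W) ** diag_mat \<mu>"
    and \<mu>: "\<And>j. norm (\<mu> $ j - d $ j) \<le> 2 * norm E"
    and W: "\<And>x. norm (W *v x) \<le> \<rho> * norm x"
    using perturbed_diagonalization[OF gap \<open>\<delta> > 0\<close> r_def] unfolding \<rho>_def by blast
  note V = near_identity[OF W \<open>\<rho> \<le> 1 / 2\<close>]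
  let ?V = "mat 1 + W"
  have "8 * norm E \<le> \<delta>"
  proof -
    have "8 * 1 * norm E \<le> 8 * ?N\<^sup>2 * norm E"
      using N by (intro mult_mono) auto
    then show ?thesis
      using small(2) by simp
  qed
  \<comment> \<open>The eigenvalues move by at most \<open>2 * norm E\<close>, less than a third of the gap.\<close>
  then have "3 * (2 * norm E) < \<delta>"
    using \<open>\<delta> > 0\<close> by (cases "E = 0") auto
  moreover have "spectrum ?A = range (($) \<mu>)"
    using spectrum_intertwined[OF V(2) AV] by (simp add: spectrum_diag_mat)
  ultimately have unit: "norm (\<mu> $ j) = 1" for j
    using reflection_symmetric_near_unit_circle[OF d gap \<mu>] small(1) symmetric by simp
  then have nz: "\<mu> $ j \<noteq> 0" for j
    by (metis norm_zero zero_neq_one)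
  have "invertible ?A"
  proof (rule invertible_if_kernel_trivial)
    fix y
    assume "?A *v y = 0"
    then have "0 = ?A *v (?V *v (matrix_inv ?V *v y))"
      using V(2) by (simp add: matrix_inv_mult_vec)
    also have "\<dots> = ?V *v (\<mu> * (matrix_inv ?V *v y))"
      by (metis AV diag_mat_mult_vec matrix_vector_mul_assoc)
    finally have "\<mu> * (matrix_inv ?V *v y) = 0"
      using V(1)[of "\<mu> * (matrix_inv ?V *v y)"] by simp
    then have "matrix_inv ?V *v y = 0"
      using nz by (simp add: vec_eq_iff)
    then show "y = 0"
      using V(2) by (metis matrix_inv_mult_vec(2) matrix_vector_mult_0_right)
  qed
  then have pow: "mat_powi ?A n ** ?V = ?V ** diag_mat (\<chi> i. \<mu> $ i powi n)"
    using mat_powi_intertwined[OF _ invertible_diag_mat[OF nz] AV] nz by (simp add: mat_powi_diag_mat)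
  define x where "x = matrix_inv ?V *v y"
  have y: "y = ?V *v x"
    using V(2) by (simp add: x_def matrix_inv_mult_vec)
  define z where "z = (\<chi> i. \<mu> $ i powi n) * x"
  have z: "norm (z $ i) = norm (x $ i)" for i
    by (simp add: z_def norm_mult norm_power_int unit)
  then have "norm z = norm x"
    by (simp add: norm_vec_def)
  have "mat_powi ?A n *v y = (mat_powi ?A n ** ?V) *v x"
    by (simp only: y matrix_vector_mul_assoc)
  also have "\<dots> = ?V *v z"
    by (simp add: pow z_def flip: matrix_vector_mul_assoc)
  finally have "mat_powi ?A n *v y = z + W *v z"
    by (simp add: matrix_vector_mult_add_rdistrib)
  then have "\<bar>norm ((mat_powi ?A n *v y) $ j) - norm (z $ j)\<bar> \<le> \<rho> * norm x"
    using norm_triangle_ineq3[of "(mat_powi ?A n *v y) $ j" "z $ j"]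
      Finite_Cartesian_Product.norm_nth_le[of "W *v z" j] W[of z]
    by (simp add: \<open>norm z = norm x\<close>)
  moreover have "\<bar>norm (y $ j) - norm (x $ j)\<bar> \<le> \<rho> * norm x"
    using norm_triangle_ineq3[of "y $ j" "x $ j"]
      Finite_Cartesian_Product.norm_nth_le[of "W *v x" j] W[of x]
    by (simp add: y matrix_vector_mult_add_rdistrib)
  ultimately have "\<bar>norm ((mat_powi ?A n *v y) $ j) - norm (y $ j)\<bar> \<le> 2 * \<rho> * norm x"
    unfolding z by simp
  also have "\<dots> \<le> 2 * \<rho> * (2 * norm y)"
    using V(1)[of x] \<open>r \<ge> 0\<close> by (intro mult_left_mono) (auto simp: y \<rho>_def)
  finally show ?thesis
    by (simp add: \<rho>_def r_def power2_eq_square mult_ac)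
qed

section \<open>Families close to the exponential\<close>

lemma sandwich_bounded:
  fixes Q :: "complex ^ 'n ^ 'm" and P :: "complex ^ 'k ^ 'l"
  shows "bounded_linear (\<lambda>X. Q ** X ** P)"
proof -
  have "linear (\<lambda>X. Q ** X ** P)"
  proof (rule linearI)
    show "Q ** (X + Y) ** P = Q ** X ** P + Q ** Y ** P" for X Y
      by (simp add: matrix_eq matrix_vector_mult_add_rdistrib matrix_vector_right_distrib
          flip: matrix_vector_mul_assoc)
    show "Q ** (a *\<^sub>R X) ** P = a *\<^sub>R (Q ** X ** P)" for a X
      by (simp add: matrix_scalar_ac scalar_matrix_assoc)
  qed
  then show ?thesis
    by (simp add: linear_conv_bounded_linear)
qed

text \<open>
  The difference of the two exponentials vanishes at \<open>h = 0\<close> and has derivative \<open>\<i> * (b - a)\<close> there.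
  Half of that slope leaves room for the higher order terms.
\<close>

lemma eventually_exp_gap:
  fixes a b :: complex
  shows "\<forall>\<^sub>F h in at (0 :: real). norm (b - a) / 2 * \<bar>h\<bar> \<le> norm (exp (\<i> * h * b) - exp (\<i> * h * a))"
proof (cases "a = b")
  case False
  let ?f = "\<lambda>z. exp (\<i> * z * b) - exp (\<i> * z * a)"
  have "(?f has_field_derivative \<i> * (b - a)) (at 0)"
    by (auto intro!: derivative_eq_intros simp: algebra_simps)
  then have "((\<lambda>z. norm (?f z / z)) \<longlongrightarrow> norm (\<i> * (b - a))) (at 0)"
    by (intro tendsto_norm) (simp add: has_field_derivative_iff)
  then have "\<forall>\<^sub>F z in at 0. norm (b - a) / 2 < norm (?f z / z)"
    using False by (intro order_tendstoD(1)) (auto simp: norm_mult)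
  moreover have "filterlim complex_of_real (at 0) (at 0)"
    by (intro filterlim_atI) (auto intro!: tendsto_eq_intros simp: eventually_at_filter)
  ultimately have "\<forall>\<^sub>F h in at (0 :: real). norm (b - a) / 2 < norm (?f h / h)"
    by (rule eventually_compose_filterlim)
  then show ?thesis
  proof (rule eventually_mono)
    fix h :: real
    assume "norm (b - a) / 2 < norm (?f h / h)"
    then show "norm (b - a) / 2 * \<bar>h\<bar> \<le> norm (?f h)"
      by (cases "h = 0") (auto simp: norm_divide field_simps)
  qed
qed simp

lemma eventually_exp_gaps:
  fixes d :: "complex ^ 'n"
  assumes "inj (($) d)"
  obtains \<gamma> where "\<gamma> > 0"
    "\<forall>\<^sub>F h in at (0 :: real). \<forall>j k. k \<noteq> j \<longrightarrow>
      \<gamma> * \<bar>h\<bar> \<le> norm (exp (\<i> * h * d $ k) - exp (\<i> * h * d $ j))"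
proof -
  define G where "G = insert 1 ((\<lambda>(j, k). norm (d $ k - d $ j) / 2) ` {(j, k). k \<noteq> j})"
  have "finite G" "G \<noteq> {}"
    by (auto simp: G_def)
  have "Min G > 0"
    using assms \<open>finite G\<close> by (auto simp: G_def inj_eq)
  moreover have "\<forall>\<^sub>F h in at (0 :: real). \<forall>j k. k \<noteq> j \<longrightarrow>
      Min G * \<bar>h\<bar> \<le> norm (exp (\<i> * h * d $ k) - exp (\<i> * h * d $ j))"
  proof (intro eventually_all_finite)
    fix j k
    show "\<forall>\<^sub>F h in at (0 :: real). k \<noteq> j \<longrightarrow>
        Min G * \<bar>h\<bar> \<le> norm (exp (\<i> * h * d $ k) - exp (\<i> * h * d $ j))"
      using eventually_exp_gap[of "d $ k" "d $ j"]
    proof (rule eventually_mono, intro impI)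
      fix h :: real
      assume "norm (d $ k - d $ j) / 2 * \<bar>h\<bar> \<le> norm (exp (\<i> * h * d $ k) - exp (\<i> * h * d $ j))"
        and "k \<noteq> j"
      moreover have "Min G \<le> norm (d $ k - d $ j) / 2"
        using \<open>finite G\<close> \<open>k \<noteq> j\<close> by (intro Min_le) (auto simp: G_def)
      then have "Min G * \<bar>h\<bar> \<le> norm (d $ k - d $ j) / 2 * \<bar>h\<bar>"
        by (rule mult_right_mono) simp
      ultimately show "Min G * \<bar>h\<bar> \<le> norm (exp (\<i> * h * d $ k) - exp (\<i> * h * d $ j))"
        by linarith
    qed
  qed
  ultimately show thesis
    by (rule that)
qed

text \<open>
  Conjugate \<open>S h\<close> into the eigenbasis of \<open>H\<close>. It becomes the diagonal matrix with the unimodular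
  entries \<open>exp (\<i> * h * d $ j)\<close>, perturbed by a matrix of size \<open>\<bar>h\<bar> ^ (p + 1)\<close>, while the gaps between
  these entries are proportional to \<open>\<bar>h\<bar>\<close>. The error of \<open>near_conservation\<close> is a
  multiple of the quotient of the two, hence of size \<open>\<bar>h\<bar> ^ p\<close>; and because \<open>p \<ge> 1\<close> the
  perturbation is indeed small compared to the gap.
\<close>

lemma coordinates_nearly_conserved:
  fixes H P :: "complex ^ 'n ^ 'n" and S :: "real \<Rightarrow> complex ^ 'n ^ 'n"
  assumes P: "invertible P" and HP: "H ** P = P ** diag_mat d"
    and inj: "inj (($) d)" and real: "\<And>j. d $ j \<in> \<real>"
    and S: "\<And>h. invertible (S h)" and cont: "isCont S 0"
    and symmetric: "\<And>h. cnj ` inverse ` spectrum (S h) \<subseteq> spectrum (S h)"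
    and p: "p \<ge> 1"
    and order_p: "(\<lambda>h. norm (S h - mat_exp (map_matrix (\<lambda>a. \<i> * of_real h * a) H)))
      \<in> O[at 0](\<lambda>h. h ^ (p + 1))"
  obtains K h\<^sub>0 where "K > 0" "0 < h\<^sub>0" "h\<^sub>0 \<le> 1"
    "\<And>h n u j. \<bar>h\<bar> < h\<^sub>0 \<Longrightarrow>
      \<bar>norm ((matrix_inv P *v (mat_powi (S h) n *v u)) $ j) - norm ((matrix_inv P *v u) $ j)\<bar>
        \<le> K * \<bar>h\<bar> ^ p * norm (matrix_inv P *v u)"
proof -
  let ?Q = "matrix_inv P"
  let ?N2 = "real (CARD('n)\<^sup>2)"
  have PQ: "?Q ** P = mat 1" "P ** ?Q = mat 1"
    using P by (simp_all add: matrix_inv_left matrix_inv_right)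
  define M where "M h = ?Q ** S h ** P" for h
  define D where "D h = (\<chi> j. exp (\<i> * of_real h * d $ j))" for h :: real
  define E where "E h = M h - diag_mat (D h)" for h
  have SP: "S h ** P = P ** M h" for h
    by (simp add: M_def matrix_mul_assoc PQ)
  have exp: "?Q ** mat_exp (map_matrix (\<lambda>a. \<i> * of_real h * a) H) ** P = diag_mat (D h)" for h
  proof -
    let ?c = "\<i> * of_real h"
    have scale: "map_matrix (\<lambda>a. ?c * a) A *v x = ?c *s (A *v x)" for A :: "complex ^ 'n ^ 'n" and x
      by (simp add: vec_eq_iff matrix_vector_mult_def sum_distrib_left mult.assoc)
    have "map_matrix (\<lambda>a. ?c * a) H *v (P *v x) = P *v (?c *s d * x)" for x
    proof -
      have "map_matrix (\<lambda>a. ?c * a) H *v (P *v x) = ?c *s (P *v (d * x))"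
        unfolding scale by (metis HP diag_mat_mult_vec matrix_vector_mul_assoc)
      also have "\<dots> = P *v (?c *s (d * x))"
        by (simp only: vector_scalar_commute)
      also have "?c *s (d * x) = ?c *s d * x"
        by (simp add: vec_eq_iff mult.assoc)
      finally show ?thesis .
    qed
    then have "map_matrix (\<lambda>a. ?c * a) H ** P = P ** diag_mat (?c *s d)"
      by (simp add: matrix_eq flip: matrix_vector_mul_assoc)
    from mat_exp_diagonalized[OF P this]
    have "mat_exp (map_matrix (\<lambda>a. ?c * a) H) = P ** diag_mat (D h) ** ?Q"
      by (simp add: D_def)
    then show ?thesis
      by (metis PQ(1) matrix_mul_assoc matrix_mul_lid matrix_mul_rid)
  qed
  obtain B where B: "B > 0" "\<And>X. norm (?Q ** X ** P) \<le> norm X * B"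
    using bounded_linear.pos_bounded[OF sandwich_bounded[of ?Q P]] by blast
  obtain c where c: "c > 0" "\<forall>\<^sub>F h in at 0.
      norm (S h - mat_exp (map_matrix (\<lambda>a. \<i> * of_real h * a) H)) \<le> c * \<bar>h\<bar> ^ (p + 1)"
    using landau_o.bigE[OF order_p] by (auto simp: power_abs abs_mult)
  define c' where "c' = c * B"
  have "c' > 0"
    using B c by (simp add: c'_def)
  have E_ev: "\<forall>\<^sub>F h in at 0. norm (E h) \<le> c' * \<bar>h\<bar> ^ (p + 1)"
    using c(2)
  proof (rule eventually_mono)
    fix h :: real
    let ?X = "S h - mat_exp (map_matrix (\<lambda>a. \<i> * of_real h * a) H)"
    assume "norm ?X \<le> c * \<bar>h\<bar> ^ (p + 1)"
    then have "norm ?X * B \<le> c * \<bar>h\<bar> ^ (p + 1) * B"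
      using B(1) by (intro mult_right_mono) auto
    moreover have "?Q ** ?X ** P = E h"
      by (simp add: E_def M_def exp linear_diff[OF bounded_linear.linear[OF sandwich_bounded]])
    ultimately show "norm (E h) \<le> c' * \<bar>h\<bar> ^ (p + 1)"
      using B(2)[of ?X] by (simp add: c'_def mult_ac)
  qed
  \<comment> \<open>The order condition does not see \<open>h = 0\<close>, where the gaps close. Continuity of \<open>S\<close> determines \<open>S 0\<close>,
      and the powers of this matrix conserve everything exactly.\<close>
  have S0: "S 0 = mat 1"
  proof -
    have "(D \<longlongrightarrow> D 0) (at 0)"
      unfolding D_def by (intro vec_tendstoI) (auto intro!: tendsto_eq_intros)
    then have "((\<lambda>h. mat 1 ** diag_mat (D h) ** mat 1) \<longlongrightarrow> mat 1 ** diag_mat (D 0) ** mat 1) (at 0)"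
      by (rule bounded_linear.tendsto[OF linear_conv_bounded_linear[THEN iffD1, OF linear_diag_mat]])
    moreover have "(M \<longlongrightarrow> M 0) (at 0)"
      unfolding M_def by (rule bounded_linear.tendsto[OF sandwich_bounded]) (use cont in \<open>simp add: isCont_def\<close>)
    ultimately have "(E \<longlongrightarrow> E 0) (at 0)"
      unfolding E_def by (intro tendsto_diff) simp_all
    moreover have "((\<lambda>h. c' * \<bar>h\<bar> ^ (p + 1)) \<longlongrightarrow> 0) (at (0 :: real))"
      by (auto intro!: tendsto_eq_intros)
    with E_ev have "(E \<longlongrightarrow> 0) (at 0)"
      by (rule Lim_null_comparison)
    ultimately have "E 0 = 0"
      by (rule tendsto_unique[OF trivial_limit_at])
    moreover have "D 0 = 1"
      by (simp add: D_def vec_eq_iff)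
    ultimately have "M 0 = mat 1"
      by (simp add: E_def diag_mat_1)
    then have "S 0 ** (P ** ?Q) = P ** ?Q"
      using SP[of 0] by (simp add: matrix_mul_assoc)
    then show ?thesis
      by (simp add: PQ)
  qed
  obtain \<gamma> where \<gamma>: "\<gamma> > 0" "\<forall>\<^sub>F h in at (0 :: real). \<forall>j k. k \<noteq> j \<longrightarrow>
      \<gamma> * \<bar>h\<bar> \<le> norm (exp (\<i> * h * d $ k) - exp (\<i> * h * d $ j))"
    using eventually_exp_gaps[OF inj] .
  obtain \<eta> where \<eta>: "\<eta> > 0" "\<And>h. h \<noteq> 0 \<Longrightarrow> \<bar>h\<bar> < \<eta> \<Longrightarrow> norm (E h) \<le> c' * \<bar>h\<bar> ^ (p + 1) \<and>
      (\<forall>j k. k \<noteq> j \<longrightarrow> \<gamma> * \<bar>h\<bar> \<le> norm (D h $ k - D h $ j))"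
    using eventually_conj[OF E_ev \<gamma>(2)] unfolding eventually_at by (auto simp: D_def dist_real_def)
  \<comment> \<open>The last two bounds turn \<open>norm (E h) \<le> c' * \<bar>h\<bar>\<^sup>2\<close> into the smallness hypotheses of
      \<open>near_conservation\<close> with \<open>\<delta> = \<gamma> * \<bar>h\<bar>\<close>.\<close>
  define h\<^sub>0 where "h\<^sub>0 = Min {1, \<eta>, 1 / (4 * c'), \<gamma> / (8 * ?N2 * c')}"
  have N2: "?N2 > 0"
    by simp
  have h\<^sub>0: "0 < h\<^sub>0" "h\<^sub>0 \<le> 1" "h\<^sub>0 \<le> \<eta>" "h\<^sub>0 \<le> 1 / (4 * c')" "h\<^sub>0 \<le> \<gamma> / (8 * ?N2 * c')"
    using \<open>c' > 0\<close> \<gamma>(1) \<eta>(1) N2 by (auto simp: h\<^sub>0_def)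
  define K where "K = 16 * ?N2 * c' / \<gamma>"
  have "K > 0"
    using \<open>c' > 0\<close> \<gamma>(1) N2 by (simp add: K_def)
  moreover have "\<bar>norm ((?Q *v (mat_powi (S h) n *v u)) $ j) - norm ((?Q *v u) $ j)\<bar>
      \<le> K * \<bar>h\<bar> ^ p * norm (?Q *v u)" if h: "\<bar>h\<bar> < h\<^sub>0" for h n u j
  proof (cases "h = 0")
    case True
    then show ?thesis
      using \<open>K > 0\<close> by (simp add: S0)
  next
    case False
    have E: "norm (E h) \<le> c' * \<bar>h\<bar> ^ (p + 1)"
      and gap: "\<And>j k. k \<noteq> j \<Longrightarrow> \<gamma> * \<bar>h\<bar> \<le> norm (D h $ k - D h $ j)"
      using \<eta>(2)[OF False] h h\<^sub>0 by auto
    have hp: "\<bar>h\<bar> ^ p \<le> \<bar>h\<bar>"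
      using power_decreasing[of 1 p "\<bar>h\<bar>"] p h h\<^sub>0(2) by simp
    have E1: "norm (E h) \<le> c' * (\<bar>h\<bar> * \<bar>h\<bar>)"
    proof -
      have "c' * \<bar>h\<bar> ^ (p + 1) \<le> c' * (\<bar>h\<bar> * \<bar>h\<bar>)"
        using mult_left_mono[OF hp, of "\<bar>h\<bar>"] \<open>c' > 0\<close> by (intro mult_left_mono) auto
      then show ?thesis
        using E by linarith
    qed
    have A: "diag_mat (D h) + E h = M h"
      by (simp add: E_def)
    have "norm (E h) \<le> 1 / 4"
    proof -
      have "\<bar>h\<bar> \<le> 1 / (4 * c')"
        using h h\<^sub>0(4) by linarith
      then have "c' * \<bar>h\<bar> \<le> 1 / 4"
        using \<open>c' > 0\<close> by (simp add: field_simps)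
      moreover have "c' * \<bar>h\<bar> * \<bar>h\<bar> \<le> c' * \<bar>h\<bar> * 1"
        using h h\<^sub>0(2) \<open>c' > 0\<close> by (intro mult_left_mono) auto
      ultimately show ?thesis
        using E1 by (simp add: mult.assoc)
    qed
    moreover have "8 * (CARD('n))\<^sup>2 * norm (E h) \<le> \<gamma> * \<bar>h\<bar>"
    proof -
      have "8 * ?N2 * norm (E h) \<le> 8 * ?N2 * (c' * (\<bar>h\<bar> * \<bar>h\<bar>))"
        using E1 by (intro mult_left_mono) auto
      also have "\<dots> = (\<bar>h\<bar> * (8 * ?N2 * c')) * \<bar>h\<bar>"
        by simp
      also have "\<dots> \<le> \<gamma> * \<bar>h\<bar>"
      proof (rule mult_right_mono)
        have "\<bar>h\<bar> \<le> \<gamma> / (8 * ?N2 * c')"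
          using h h\<^sub>0(5) by linarith
        then show "\<bar>h\<bar> * (8 * ?N2 * c') \<le> \<gamma>"
          using \<open>c' > 0\<close> N2 by (subst (asm) pos_le_divide_eq) auto
      qed simp
      finally show ?thesis
        by simp
    qed
    moreover have "norm (D h $ j) = 1" for j
      using real[of j] by (auto simp: D_def elim!: Reals_cases)
    moreover have "cnj ` inverse ` spectrum (diag_mat (D h) + E h) \<subseteq> spectrum (diag_mat (D h) + E h)"
      unfolding A spectrum_intertwined[OF P SP, symmetric] by (rule symmetric)
    moreover have "\<gamma> * \<bar>h\<bar> > 0"
      using \<gamma>(1) False by simp
    ultimately have main: "\<bar>norm ((mat_powi (M h) n *v (?Q *v u)) $ j) - norm ((?Q *v u) $ j)\<bar>
        \<le> 16 * (CARD('n))\<^sup>2 * norm (E h) / (\<gamma> * \<bar>h\<bar>) * norm (?Q *v u)"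
      using near_conservation[OF _ gap, of "E h" n "?Q *v u" j] unfolding A by blast
    have "invertible (M h)"
      unfolding M_def using S P PQ by (intro invertible_mult) (auto simp: invertible_def)
    then have pow: "mat_powi (S h) n ** P = P ** mat_powi (M h) n"
      using mat_powi_intertwined[OF S _ SP] by blast
    have "?Q *v (mat_powi (S h) n *v u) = ?Q *v ((mat_powi (S h) n ** P) *v (?Q *v u))"
      using P by (simp add: matrix_inv_mult_vec flip: matrix_vector_mul_assoc)
    also have "\<dots> = mat_powi (M h) n *v (?Q *v u)"
      unfolding pow using P by (simp add: matrix_inv_mult_vec flip: matrix_vector_mul_assoc)
    finally have "?Q *v (mat_powi (S h) n *v u) = mat_powi (M h) n *v (?Q *v u)" .
    moreover have "16 * (CARD('n))\<^sup>2 * norm (E h) / (\<gamma> * \<bar>h\<bar>) \<le> K * \<bar>h\<bar> ^ p"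
    proof -
      have "16 * ?N2 * norm (E h) / (\<gamma> * \<bar>h\<bar>) \<le> 16 * ?N2 * (c' * \<bar>h\<bar> ^ (p + 1)) / (\<gamma> * \<bar>h\<bar>)"
        using E \<gamma>(1) by (intro divide_right_mono mult_left_mono) auto
      also have "\<dots> = K * \<bar>h\<bar> ^ p"
        using False \<gamma>(1) by (simp add: K_def field_simps)
      finally show ?thesis
        by simp
    qed
    ultimately show ?thesis
      using main by (metis (no_types, lifting) mult_right_mono norm_ge_zero order_trans)
  qed
  ultimately show thesis
    using h\<^sub>0(1,2) that by blast
qed

section \<open>Mass and energy in an orthogonal eigenbasis\<close>

text \<open>
  The Hermitian inner product, linear in the second argument, so that \<open>energy H u\<close> is
  \<open>cdot u (H *v u)\<close>.
\<close>

definition cdot :: "complex ^ 'n \<Rightarrow> complex ^ 'n \<Rightarrow> complex" where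
  "cdot u v = (\<Sum>i\<in>UNIV. cnj (u $ i) * v $ i)"

lemma cdot_self: "cdot u u = of_real ((norm u)\<^sup>2)"
proof -
  have "cdot u u = (\<Sum>i\<in>UNIV. of_real ((norm (u $ i))\<^sup>2))"
    unfolding cdot_def by (intro sum.cong refl) (simp only: complex_norm_square mult.commute)
  also have "\<dots> = of_real ((norm u)\<^sup>2)"
    by (simp add: norm_vec_def L2_set_def sum_nonneg)
  finally show ?thesis .
qed

lemma cdot_scale_left: "cdot (a *s u) v = cnj a * cdot u v"
  by (simp add: cdot_def sum_distrib_left mult_ac)

lemma cdot_scale_right: "cdot u (a *s v) = a * cdot u v"
  by (simp add: cdot_def sum_distrib_left mult_ac)

lemma cdot_sum_left: "cdot (\<Sum>j\<in>I. u j) v = (\<Sum>j\<in>I. cdot (u j) v)"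
  unfolding cdot_def by (simp add: sum_distrib_right) (rule sum.swap)

lemma cdot_sum_right: "cdot u (\<Sum>j\<in>I. v j) = (\<Sum>j\<in>I. cdot u (v j))"
  unfolding cdot_def by (simp add: sum_distrib_left) (rule sum.swap)

lemma cdot_hermitian:
  assumes "hermitian A"
  shows "cdot (A *v u) v = cdot u (A *v v)"
proof -
  have A: "cnj (A $ i $ j) = A $ j $ i" for i j
    using arg_cong[where f = "\<lambda>X. X $ j $ i", OF assms[unfolded hermitian_def]]
    by (simp add: transpose_def)
  have "cdot (A *v u) v = (\<Sum>i\<in>UNIV. \<Sum>j\<in>UNIV. A $ j $ i * cnj (u $ j) * v $ i)"
    by (simp add: cdot_def matrix_vector_mult_def sum_distrib_right A)
  also have "\<dots> = (\<Sum>j\<in>UNIV. \<Sum>i\<in>UNIV. A $ j $ i * cnj (u $ j) * v $ i)"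
    by (rule sum.swap)
  also have "\<dots> = cdot u (A *v v)"
    by (simp add: cdot_def matrix_vector_mult_def sum_distrib_left mult_ac)
  finally show ?thesis .
qed

lemma hermitian_eigenvectors_orthogonal:
  assumes "hermitian A" "A *v u = a *s u" "A *v v = b *s v" "a \<in> \<real>" "a \<noteq> b"
  shows "cdot u v = 0"
proof -
  have "a * cdot u v = b * cdot u v"
    using cdot_hermitian[OF assms(1), of u v] assms(2-4)
    by (simp add: cdot_scale_left cdot_scale_right Reals_cnj_iff)
  then show ?thesis
    using assms(5) by simp
qed

lemma cdot_orthogonal_sum:
  fixes w :: "'n::finite \<Rightarrow> complex ^ 'm"
  assumes "\<And>j k. j \<noteq> k \<Longrightarrow> cdot (w j) (w k) = 0"
  shows "cdot (\<Sum>j\<in>UNIV. w j) (\<Sum>k\<in>UNIV. e k *s w k) = (\<Sum>j\<in>UNIV. e j * of_real ((norm (w j))\<^sup>2))"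
proof -
  have "cdot (w j) (\<Sum>k\<in>UNIV. e k *s w k) = e j * of_real ((norm (w j))\<^sup>2)" for j
  proof -
    have "cdot (w j) (\<Sum>k\<in>UNIV. e k *s w k) = (\<Sum>k\<in>UNIV. if k = j then e j * cdot (w j) (w j) else 0)"
      unfolding cdot_sum_right cdot_scale_right using assms by (intro sum.cong) auto
    then show ?thesis
      by (simp add: cdot_self)
  qed
  then show ?thesis
    by (simp add: cdot_sum_left)
qed

text \<open>
  For Hermitian \<open>H\<close> the spectral components of \<open>u\<close> are pairwise orthogonal, so mass and energy are
  functions of their norms alone. These norms are what the integrator nearly conserves.
\<close>

lemma mass_energy_spectral:
  fixes H P :: "complex ^ 'n ^ 'n"
  assumes P: "invertible P" and HP: "H ** P = P ** diag_mat d"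
    and inj: "inj (($) d)" and real: "\<And>j. d $ j \<in> \<real>" and H: "hermitian H"
  shows "mass u = (\<Sum>j\<in>UNIV. (norm (spectral_projector H (d $ j) u))\<^sup>2)"
    and "energy H u = (\<Sum>j\<in>UNIV. d $ j * of_real ((norm (spectral_projector H (d $ j) u))\<^sup>2))"
proof -
  let ?w = "\<lambda>j. spectral_projector H (d $ j) u"
  have w: "?w j = (matrix_inv P *v u) $ j *s column j P" for j
    by (rule spectral_projector_diagonalized[OF P HP inj])
  have u: "u = (\<Sum>j\<in>UNIV. ?w j)"
    unfolding w by (metis P matrix_inv_mult_vec(2) matrix_mult_sum)
  have Hw: "H *v ?w j = d $ j *s ?w j" for j
  proof -
    have "H *v column j P = P *v (d * axis j 1)"
      by (metis HP diag_mat_mult_vec matrix_vector_mul_assoc matrix_vector_mult_axis)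
    also have "d * axis j 1 = d $ j *s axis j 1"
      by (simp add: vec_eq_iff axis_def)
    finally have "H *v column j P = d $ j *s column j P"
      by (simp add: vector_scalar_commute matrix_vector_mult_axis)
    then show ?thesis
      by (simp add: w vector_scalar_commute vector_smult_assoc mult.commute)
  qed
  have orth: "cdot (?w j) (?w k) = 0" if "j \<noteq> k" for j k
    using hermitian_eigenvectors_orthogonal[OF H Hw Hw real] inj that by (auto simp: inj_eq)
  have "complex_of_real (mass u) = cdot (\<Sum>j\<in>UNIV. ?w j) (\<Sum>k\<in>UNIV. 1 *s ?w k)"
    by (simp add: mass_def cdot_self flip: u)
  also have "\<dots> = of_real (\<Sum>j\<in>UNIV. (norm (?w j))\<^sup>2)"
    by (subst cdot_orthogonal_sum[OF orth]) simp_all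
  finally show "mass u = (\<Sum>j\<in>UNIV. (norm (?w j))\<^sup>2)"
    by (simp only: of_real_eq_iff)
  have "H *v u = (\<Sum>k\<in>UNIV. d $ k *s ?w k)"
    by (subst u) (simp only: vec.linear_sum[OF matrix_vector_mul_linear_gen] Hw)
  then have "energy H u = cdot (\<Sum>j\<in>UNIV. ?w j) (\<Sum>k\<in>UNIV. d $ k *s ?w k)"
    by (simp add: energy_def cdot_def flip: u)
  also have "\<dots> = (\<Sum>j\<in>UNIV. d $ j * of_real ((norm (?w j))\<^sup>2))"
    by (rule cdot_orthogonal_sum[OF orth])
  finally show "energy H u = (\<Sum>j\<in>UNIV. d $ j * of_real ((norm (?w j))\<^sup>2))" .
qed

section \<open>Near conservation for all times\<close>

text \<open>
  Here \<open>e\<close> is the error of a norm \<open>a\<close> whose exact value \<open>b\<close> is at most \<open>U\<close>. The hypothesis \<open>e \<le> K * U\<close>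
  bounds \<open>a + b\<close> by a multiple of \<open>U\<close>.
\<close>

lemma abs_diff_squares_le:
  fixes a b :: real
  assumes "0 \<le> a" "0 \<le> b" "\<bar>a - b\<bar> \<le> e" "b \<le> U" "e \<le> K * U"
  shows "\<bar>a\<^sup>2 - b\<^sup>2\<bar> \<le> e * ((K + 2) * U)"
proof -
  have "\<bar>a\<^sup>2 - b\<^sup>2\<bar> = \<bar>a - b\<bar> * (a + b)"
    using assms(1,2) by (simp add: power2_eq_square square_diff_square_factored abs_mult)
  also have "\<dots> \<le> e * ((K + 2) * U)"
    using assms by (intro mult_mono) (auto simp: algebra_simps)
  finally show ?thesis .
qed

theorem corollary3p3:
  fixes H :: "complex ^ 'n ^ 'n"
    and S :: "real \<Rightarrow> complex ^ 'n ^ 'n"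
    and p :: nat
  assumes invertible: "\<And>h. invertible (S h)"
    and smooth: "smooth S"
    and spectrum_symmetric: "\<And>h. spectrum (S h) = cnj ` inverse ` spectrum (S h)"
    and p: "p \<ge> 1"
    and order_p: "(\<lambda>h. norm (S h - mat_exp (map_matrix (\<lambda>a. \<i> * of_real h * a) H)))
                    \<in> O[at 0](\<lambda>h. h ^ (p + 1))"
    and eigenvalues_real: "\<And>\<omega>. \<omega> \<in> spectrum H \<Longrightarrow> \<omega> \<in> \<real>"
    and eigenvalues_simple: "\<And>\<omega>. \<omega> \<in> spectrum H \<Longrightarrow> simple_eigenvalue H \<omega>"
  shows "\<exists>C > 0. \<exists>h\<^sub>0 > 0. \<forall>h. \<bar>h\<bar> < h\<^sub>0 \<longrightarrow>
    (\<forall>u. \<forall>\<omega> \<in> spectrum H.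
      (SUP n::nat. ereal \<bar>norm (spectral_projector H \<omega> (mat_pow (S h) n *v u))
                          - norm (spectral_projector H \<omega> u)\<bar>)
        \<le> ereal (C * \<bar>h\<bar> ^ p * norm u)) \<and>
    (hermitian H \<longrightarrow>
      (\<forall>u.
        (SUP n::int. ereal \<bar>mass (mat_powi (S h) n *v u) - mass u\<bar>)
          \<le> ereal (C * \<bar>h\<bar> ^ p * (norm u)\<^sup>2) \<and>
        (SUP n::int. ereal (norm (energy H (mat_powi (S h) n *v u) - energy H u)))
          \<le> ereal (C * \<bar>h\<bar> ^ p * (norm u)\<^sup>2)))"
proof -
  obtain P :: "complex ^ 'n ^ 'n" and d
    where P: "invertible P" and HP: "H ** P = P ** diag_mat d" and inj: "inj (($) d)"
    using simple_eigenvalues_diagonalize[OF eigenvalues_simple] .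
  have spec: "spectrum H = range (($) d)"
    using spectrum_intertwined[OF P HP] by (simp add: spectrum_diag_mat)
  have real: "d $ j \<in> \<real>" for j
    using eigenvalues_real by (simp add: spec)
  obtain D where "D 0 = S" "\<And>t. (D 0 has_vector_derivative D (Suc 0) t) (at t)"
    using smooth unfolding smooth_def by blast
  then have cont: "isCont S 0"
    using has_vector_derivative_continuous by blast
  have sym: "cnj ` inverse ` spectrum (S h) \<subseteq> spectrum (S h)" for h
    by (rule equalityD2[OF spectrum_symmetric])
  obtain K h\<^sub>0 where K: "K > 0" and h\<^sub>0: "0 < h\<^sub>0" "h\<^sub>0 \<le> 1"
    and coord: "\<And>h n u j. \<bar>h\<bar> < h\<^sub>0 \<Longrightarrow>
      \<bar>norm ((matrix_inv P *v (mat_powi (S h) n *v u)) $ j) - norm ((matrix_inv P *v u) $ j)\<bar>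
        \<le> K * \<bar>h\<bar> ^ p * norm (matrix_inv P *v u)"
    using coordinates_nearly_conserved[OF P HP inj real invertible cont sym p order_p] by blast
  define L where "L = K * norm (matrix_inv P) * norm P"
  have "L \<ge> 0"
    using K by (simp add: L_def)
  define Q where "Q j = spectral_projector H (d $ j)" for j
  have drift: "\<bar>norm (Q j (mat_powi (S h) n *v u)) - norm (Q j u)\<bar> \<le> L * \<bar>h\<bar> ^ p * norm u"
    if h: "\<bar>h\<bar> < h\<^sub>0" for h n u j
  proof -
    have norm_Q: "norm (Q j v) = norm ((matrix_inv P *v v) $ j) * norm (column j P)" for v
      by (simp add: Q_def spectral_projector_diagonalized[OF P HP inj] norm_vector_scalar_mult)
    have "\<bar>norm (Q j (mat_powi (S h) n *v u)) - norm (Q j u)\<bar> =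
        \<bar>norm ((matrix_inv P *v (mat_powi (S h) n *v u)) $ j) - norm ((matrix_inv P *v u) $ j)\<bar>
          * norm (column j P)"
      unfolding norm_Q left_diff_distrib[symmetric] by (simp add: abs_mult)
    also have "\<dots> \<le> (K * \<bar>h\<bar> ^ p * (norm (matrix_inv P) * norm u)) * norm P"
    proof (rule mult_mono)
      have "K * \<bar>h\<bar> ^ p * norm (matrix_inv P *v u) \<le> K * \<bar>h\<bar> ^ p * (norm (matrix_inv P) * norm u)"
        using K by (intro mult_left_mono norm_matrix_vector_mult_le) simp
      then show "\<bar>norm ((matrix_inv P *v (mat_powi (S h) n *v u)) $ j) - norm ((matrix_inv P *v u) $ j)\<bar>
          \<le> K * \<bar>h\<bar> ^ p * (norm (matrix_inv P) * norm u)"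
        using coord[OF h, of n u j] by linarith
      show "norm (column j P) \<le> norm P"
        using norm_matrix_vector_mult_le[of P "axis j 1"] by (simp add: matrix_vector_mult_axis)
    qed (use K in auto)
    finally show ?thesis
      by (simp add: L_def mult_ac)
  qed
  have squares: "\<bar>(norm (Q j (mat_powi (S h) n *v u)))\<^sup>2 - (norm (Q j u))\<^sup>2\<bar>
      \<le> L * (L + 2) * (\<bar>h\<bar> ^ p * (norm u)\<^sup>2)"
    if H: "hermitian H" and h: "\<bar>h\<bar> < h\<^sub>0" for h n u j
  proof -
    have "(norm (Q j u))\<^sup>2 \<le> (norm u)\<^sup>2"
      using mass_energy_spectral(1)[OF P HP inj real H, of u]
        member_le_sum[of j UNIV "\<lambda>j. (norm (Q j u))\<^sup>2"] by (simp add: mass_def Q_def)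
    then have "norm (Q j u) \<le> norm u"
      by simp
    moreover have "L * \<bar>h\<bar> ^ p * norm u \<le> L * norm u"
      using h h\<^sub>0(2) \<open>L \<ge> 0\<close> power_le_one[of "\<bar>h\<bar>" p]
      by (intro mult_right_mono) (auto simp: mult_left_le)
    ultimately have "\<bar>(norm (Q j (mat_powi (S h) n *v u)))\<^sup>2 - (norm (Q j u))\<^sup>2\<bar>
        \<le> L * \<bar>h\<bar> ^ p * norm u * ((L + 2) * norm u)"
      using drift[OF h] by (intro abs_diff_squares_le) auto
    then show ?thesis
      by (simp add: power2_eq_square mult_ac)
  qed
  \<comment> \<open>One weight for both invariants: mass has weights 1 on the spectral components, energy has the
      eigenvalues as weights.\<close>
  define W where "W = real CARD('n) + (\<Sum>j\<in>UNIV. norm (d $ j))"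
  define C where "C = 1 + L + W * (L * (L + 2))"
  have "W \<ge> 0"
    by (simp add: W_def sum_nonneg)
  then have C: "C > 0" "L \<le> C" "W * (L * (L + 2)) \<le> C"
    using \<open>L \<ge> 0\<close> by (auto simp: C_def intro: add_pos_nonneg)
  have weighted: "(\<Sum>j\<in>UNIV. norm (e j) * \<bar>(norm (Q j (mat_powi (S h) n *v u)))\<^sup>2 - (norm (Q j u))\<^sup>2\<bar>)
      \<le> C * \<bar>h\<bar> ^ p * (norm u)\<^sup>2"
    if "hermitian H" and "\<bar>h\<bar> < h\<^sub>0" and e: "(\<Sum>j\<in>UNIV. norm (e j)) \<le> W"
    for h n u and e :: "'n \<Rightarrow> complex"
  proof -
    let ?q = "L * (L + 2) * (\<bar>h\<bar> ^ p * (norm u)\<^sup>2)"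
    have "(\<Sum>j\<in>UNIV. norm (e j) * \<bar>(norm (Q j (mat_powi (S h) n *v u)))\<^sup>2 - (norm (Q j u))\<^sup>2\<bar>)
        \<le> (\<Sum>j\<in>UNIV. norm (e j)) * ?q"
      unfolding sum_distrib_right by (intro sum_mono mult_left_mono squares that) simp
    also have "\<dots> \<le> W * ?q"
      using e \<open>L \<ge> 0\<close> by (intro mult_right_mono) auto
    also have "\<dots> = W * (L * (L + 2)) * (\<bar>h\<bar> ^ p * (norm u)\<^sup>2)"
      by (simp only: mult.assoc)
    also have "\<dots> \<le> C * (\<bar>h\<bar> ^ p * (norm u)\<^sup>2)"
      using C(3) by (intro mult_right_mono) auto
    finally show ?thesis
      by (simp only: mult.assoc)
  qed
  have "(SUP n::nat. ereal \<bar>norm (spectral_projector H \<omega> (mat_pow (S h) n *v u))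
        - norm (spectral_projector H \<omega> u)\<bar>) \<le> ereal (C * \<bar>h\<bar> ^ p * norm u)"
    if h: "\<bar>h\<bar> < h\<^sub>0" and \<omega>: "\<omega> \<in> spectrum H" for h u \<omega>
  proof (rule SUP_least)
    fix n :: nat
    obtain j where j: "\<omega> = d $ j"
      using \<omega> by (auto simp: spec)
    have "L * \<bar>h\<bar> ^ p * norm u \<le> C * \<bar>h\<bar> ^ p * norm u"
      using C(2) by (intro mult_right_mono) auto
    then show "ereal \<bar>norm (spectral_projector H \<omega> (mat_pow (S h) n *v u))
        - norm (spectral_projector H \<omega> u)\<bar> \<le> ereal (C * \<bar>h\<bar> ^ p * norm u)"
      using drift[OF h, of j "int n" u] by (simp add: Q_def j mat_powi_def)
  qed
  moreover have "(SUP n::int. ereal \<bar>mass (mat_powi (S h) n *v u) - mass u\<bar>)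
      \<le> ereal (C * \<bar>h\<bar> ^ p * (norm u)\<^sup>2)" if "\<bar>h\<bar> < h\<^sub>0" and H: "hermitian H" for h u
  proof (rule SUP_least)
    fix n :: int
    have "\<bar>mass (mat_powi (S h) n *v u) - mass u\<bar>
        = \<bar>\<Sum>j\<in>UNIV. (norm (Q j (mat_powi (S h) n *v u)))\<^sup>2 - (norm (Q j u))\<^sup>2\<bar>"
      unfolding mass_energy_spectral(1)[OF P HP inj real H] Q_def by (simp add: sum_subtractf)
    also have "\<dots> \<le> (\<Sum>j\<in>UNIV. norm (1 :: complex) *
        \<bar>(norm (Q j (mat_powi (S h) n *v u)))\<^sup>2 - (norm (Q j u))\<^sup>2\<bar>)"
      by simp
    also have "\<dots> \<le> C * \<bar>h\<bar> ^ p * (norm u)\<^sup>2"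
      using that by (intro weighted) (auto simp: W_def sum_nonneg)
    finally show "ereal \<bar>mass (mat_powi (S h) n *v u) - mass u\<bar> \<le> ereal (C * \<bar>h\<bar> ^ p * (norm u)\<^sup>2)"
      by simp
  qed
  moreover have "(SUP n::int. ereal (norm (energy H (mat_powi (S h) n *v u) - energy H u)))
      \<le> ereal (C * \<bar>h\<bar> ^ p * (norm u)\<^sup>2)" if "\<bar>h\<bar> < h\<^sub>0" and H: "hermitian H" for h u
  proof (rule SUP_least)
    fix n :: int
    have "energy H (mat_powi (S h) n *v u) - energy H u
        = (\<Sum>j\<in>UNIV. d $ j * of_real ((norm (Q j (mat_powi (S h) n *v u)))\<^sup>2 - (norm (Q j u))\<^sup>2))"
      unfolding mass_energy_spectral(2)[OF P HP inj real H] Q_def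
      by (simp add: sum_subtractf right_diff_distrib)
    then have "norm (energy H (mat_powi (S h) n *v u) - energy H u)
        \<le> (\<Sum>j\<in>UNIV. norm (d $ j) * \<bar>(norm (Q j (mat_powi (S h) n *v u)))\<^sup>2 - (norm (Q j u))\<^sup>2\<bar>)"
      by (simp only:) (rule order_trans[OF norm_sum], simp only: norm_mult norm_of_real order_refl)
    also have "\<dots> \<le> C * \<bar>h\<bar> ^ p * (norm u)\<^sup>2"
      using that by (intro weighted) (auto simp: W_def)
    finally show "ereal (norm (energy H (mat_powi (S h) n *v u) - energy H u))
        \<le> ereal (C * \<bar>h\<bar> ^ p * (norm u)\<^sup>2)"
      by simp
  qed
  ultimately show ?thesis
    using C(1) h\<^sub>0(1) by blast
qed

end
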